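(* Let $T$ and $S$ be commuting mean ergodic contractions on a Banach space $X$, with $F(T)=F(S)$, and assume that $T$ is uniformly ergodic. Then: (i) Every coboundary of $S$ (i.e. every element of $(I-S)X$), in particular every joint coboundary of $T$ and $S$, is a double coboundary, i.e. belongs to $(I-T)(I-S)X$. (ii) $\displaystyle \lim_{\min(n,m)\to\infty}\Big\|\frac1{nm}\sum_{k=0}^{n}\sum_{j=0}^{m}T^kS^j-E\Big\|=0$, where $E$ is the projection on $F(T)$ with null space $(I-T)X$.
   Context: A contraction of a Banach space $X$ is a linear operator $T:X\to X$ with $\|T\|\le 1$. $F(T)=\{x\in X: Tx=x\}$. A contraction $T$ is mean ergodic if the averages $\frac1n\sum_{k=0}^{n-1}T^k$ converge in the strong operator topology, and uniformly ergodic if they converge in operator norm. Elements of $(I-T)X\cap(I-S)X$ are joint coboundaries of $T$ and $S$; elements of $(I-T)(I-S)X$ are double coboundaries. *)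

theory Defs
  imports "HOL-Analysis.Analysis"
begin

(* Bounded operators on X are elements of 'a =>_L 'a, whose norm is the operator norm.
   As that type has no multiplicative structure, powers are iterated compositions. *)

definition op_power :: "('a::real_normed_vector \<Rightarrow>\<^sub>L 'a) \<Rightarrow> nat \<Rightarrow> 'a \<Rightarrow>\<^sub>L 'a" where
  "op_power T k = (((o\<^sub>L) T) ^^ k) id_blinfun"

definition contraction_op :: "('a::real_normed_vector \<Rightarrow>\<^sub>L 'a) \<Rightarrow> bool" where
  "contraction_op T \<longleftrightarrow> norm T \<le> 1"

definition fixed_space :: "('a::real_normed_vector \<Rightarrow>\<^sub>L 'a) \<Rightarrow> 'a set" where
  "fixed_space T = {x. T x = x}"

definition ergodic_average :: "('a::real_normed_vector \<Rightarrow>\<^sub>L 'a) \<Rightarrow> nat \<Rightarrow> 'a \<Rightarrow>\<^sub>L 'a" where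
  "ergodic_average T n = (1 / real n) *\<^sub>R (\<Sum>k<n. op_power T k)"

definition mean_ergodic :: "('a::real_normed_vector \<Rightarrow>\<^sub>L 'a) \<Rightarrow> bool" where
  "mean_ergodic T \<longleftrightarrow> (\<exists>P. limitin strong_operator_topology (ergodic_average T) P sequentially)"

definition uniformly_ergodic :: "('a::real_normed_vector \<Rightarrow>\<^sub>L 'a) \<Rightarrow> bool" where
  "uniformly_ergodic T \<longleftrightarrow> convergent (ergodic_average T)"

definition coboundaries :: "('a::real_normed_vector \<Rightarrow>\<^sub>L 'a) \<Rightarrow> 'a set" where
  "coboundaries T = range (blinfun_apply (id_blinfun - T))"

definition joint_coboundaries ::
    "('a::real_normed_vector \<Rightarrow>\<^sub>L 'a) \<Rightarrow> ('a \<Rightarrow>\<^sub>L 'a) \<Rightarrow> 'a set" where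
  "joint_coboundaries T S = coboundaries T \<inter> coboundaries S"

definition double_coboundaries ::
    "('a::real_normed_vector \<Rightarrow>\<^sub>L 'a) \<Rightarrow> ('a \<Rightarrow>\<^sub>L 'a) \<Rightarrow> 'a set" where
  "double_coboundaries T S = range (blinfun_apply ((id_blinfun - T) o\<^sub>L (id_blinfun - S)))"

definition is_projection_on_along ::
    "('a::real_normed_vector \<Rightarrow>\<^sub>L 'a) \<Rightarrow> 'a set \<Rightarrow> 'a set \<Rightarrow> bool" where
  "is_projection_on_along E U V \<longleftrightarrow>
     E o\<^sub>L E = E \<and> range (blinfun_apply E) = U \<and> {x. E x = 0} = V"

end

theory Submission
  imports Defs
begin

text \<open>
  Let \<open>P\<close> be the norm limit of the averages \<open>A\<^sub>n\<close> of \<open>T\<close>. It is a projection onto the fixed space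
  of \<open>T\<close>. If \<open>P x = 0\<close> and \<open>\<parallel>A\<^sub>n - P\<parallel> < 1\<close>, solve \<open>y - (A\<^sub>n - P) y = x\<close>; applying \<open>P\<close> shows
  \<open>P y = 0\<close>, so \<open>x = (I - A\<^sub>n) y\<close>, which is a coboundary because \<open>I - T\<close> divides \<open>I - A\<^sub>n\<close>. Hence
  the null space of \<open>P\<close> is \<open>(I - T) X\<close>. For (i), \<open>(I - S) u = (I - S) (u - P u)\<close> as \<open>S P = P\<close>, and
  \<open>u - P u\<close> is a coboundary of \<open>T\<close>. For (ii), \<open>P\<close> absorbs the powers of \<open>S\<close>, and the averages
  of \<open>S\<close> are bounded, so the double averages inherit the norm convergence of those of \<open>T\<close>.
\<close>

section \<open>Algebra of powers and averages, and solving \<open>y - D y = x\<close> for small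
  \<open>D\<close>\<close>

lemma op_power_0 [simp]: "op_power T 0 = id_blinfun"
  by (simp add: op_power_def)

lemma op_power_Suc [simp]: "op_power T (Suc k) = T o\<^sub>L op_power T k"
  by (simp add: op_power_def)

interpretation blinfun_compose: bounded_bilinear "(o\<^sub>L)"
  by (rule bounded_bilinear_blinfun_compose)

lemma blinfun_compose_assoc: "(f o\<^sub>L g) o\<^sub>L h = f o\<^sub>L (g o\<^sub>L h)"
  by (rule blinfun_eqI) simp

lemma blinfun_compose_id [simp]: "id_blinfun o\<^sub>L f = f" "f o\<^sub>L id_blinfun = f"
  by (auto intro: blinfun_eqI)

lemma op_power_commute:
  assumes "T o\<^sub>L S = S o\<^sub>L T"
  shows "op_power T k o\<^sub>L S = S o\<^sub>L op_power T k"
  by (induction k) (simp_all add: blinfun_compose_assoc, metis assms blinfun_compose_assoc)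

lemma ergodic_average_commute:
  assumes "T o\<^sub>L S = S o\<^sub>L T"
  shows "ergodic_average T n o\<^sub>L S = S o\<^sub>L ergodic_average T n"
  by (simp add: ergodic_average_def blinfun_compose.scaleR_left blinfun_compose.scaleR_right
      blinfun_compose.sum_left blinfun_compose.sum_right op_power_commute[OF assms])

lemma op_power_absorb_left:
  assumes "T o\<^sub>L P = P"
  shows "op_power T k o\<^sub>L P = P"
  by (induction k) (simp_all add: assms blinfun_compose_assoc)

lemma ergodic_average_absorb_left:
  assumes "T o\<^sub>L P = P" "n > 0"
  shows "ergodic_average T n o\<^sub>L P = P"
  using assms(2)
  by (simp add: ergodic_average_def blinfun_compose.scaleR_left blinfun_compose.sum_left
      op_power_absorb_left[OF assms(1)] sum_constant_scaleR)

lemma norm_op_power_le_1: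
  assumes "contraction_op T"
  shows "norm (op_power T k) \<le> 1"
proof (induction k)
  case 0
  show ?case by (simp add: norm_blinfun_id_le)
next
  case (Suc k)
  have "norm (op_power T (Suc k)) \<le> norm T * norm (op_power T k)"
    by (simp add: norm_blinfun_compose)
  also have "\<dots> \<le> 1"
    using assms Suc by (intro mult_le_one) (auto simp: contraction_op_def)
  finally show ?case .
qed

lemma op_power_telescope:
  "(id_blinfun - T) o\<^sub>L (\<Sum>k<n. op_power T k) = id_blinfun - op_power T n"
  by (induction n)
    (simp_all add: blinfun_compose.add_right blinfun_compose.diff_left blinfun_compose.zero_right)

text \<open>Each \<open>id_blinfun - op_power T k\<close> telescopes into
  \<open>id_blinfun - T\<close> times a sum of lower powers; \<open>B\<close> is the average of
  these sums over \<open>k < n\<close>.\<close>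

lemma id_minus_ergodic_average_factor:
  assumes "n > 0"
  obtains B where "id_blinfun - ergodic_average T n = (id_blinfun - T) o\<^sub>L B"
proof
  have "id_blinfun - ergodic_average T n = (1 / real n) *\<^sub>R (\<Sum>k<n. id_blinfun - op_power T k)"
    using assms by (simp add: ergodic_average_def sum_subtractf scaleR_diff_right sum_constant_scaleR)
  also have "\<dots> = (id_blinfun - T) o\<^sub>L ((1 / real n) *\<^sub>R (\<Sum>k<n. \<Sum>j<k. op_power T j))"
    by (simp add: blinfun_compose.scaleR_right blinfun_compose.sum_right[of _ _ "{..<n}"]
        op_power_telescope)
  finally show "id_blinfun - ergodic_average T n =
    (id_blinfun - T) o\<^sub>L ((1 / real n) *\<^sub>R (\<Sum>k<n. \<Sum>j<k. op_power T j))" .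
qed

text \<open>The solution is the fixed point of the map sending \<open>y\<close> to
  \<open>x + D y\<close>, whose Lipschitz constant is \<open>norm D\<close>. Completeness of the
  space enters here.\<close>

lemma surj_id_minus_small:
  fixes D :: "'a::banach \<Rightarrow>\<^sub>L 'a"
  assumes "norm D < 1"
  obtains y where "y - D y = x"
proof -
  have "\<exists>!y. x + D y = y"
  proof (rule banach_fix_type)
    show "\<forall>u v. dist (x + D u) (x + D v) \<le> norm D * dist u v"
      by (simp add: dist_norm norm_blinfun flip: blinfun.diff_right)
  qed (use assms in auto)
  then show thesis
    using that by (metis add_diff_cancel_right')
qed

section \<open>The norm limit of the averages as a projection\<close>

lemma ergodic_limit_absorbs:
  fixes T P :: "'a::real_normed_vector \<Rightarrow>\<^sub>L 'a"
  assumes "contraction_op T" "ergodic_average T \<longlonglongrightarrow> P"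
  shows "T o\<^sub>L P = P"
proof -
  have "(\<lambda>n. (id_blinfun - T) o\<^sub>L ergodic_average T n) \<longlonglongrightarrow> 0"
  proof (rule Lim_null_comparison)
    \<comment> \<open>Telescoping leaves \<open>id_blinfun - op_power T n\<close> divided by
      \<open>n\<close>. For \<open>n = 0\<close> both sides are 0, as division by zero gives
      0.\<close>
    have "norm ((id_blinfun - T) o\<^sub>L ergodic_average T n) \<le> 2 / real n" for n
    proof -
      have "norm ((id_blinfun - T) o\<^sub>L ergodic_average T n) = norm (id_blinfun - op_power T n) / real n"
        by (simp add: ergodic_average_def blinfun_compose.scaleR_right op_power_telescope)
      also have "\<dots> \<le> 2 / real n"
        using norm_triangle_ineq4[of id_blinfun "op_power T n"] norm_op_power_le_1[OF assms(1), of 0]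
          norm_op_power_le_1[OF assms(1), of n]
        by (intro divide_right_mono) auto
      finally show ?thesis .
    qed
    then show "\<forall>\<^sub>F n in sequentially. norm ((id_blinfun - T) o\<^sub>L ergodic_average T n) \<le> 2 / real n"
      by simp
  qed (rule lim_const_over_n)
  moreover have "(\<lambda>n. (id_blinfun - T) o\<^sub>L ergodic_average T n) \<longlonglongrightarrow> ((id_blinfun - T) o\<^sub>L P)"
    by (intro blinfun_compose.tendsto tendsto_const assms)
  ultimately have "(id_blinfun - T) o\<^sub>L P = 0"
    using LIMSEQ_unique by blast
  then show ?thesis
    by (simp add: blinfun_compose.diff_left)
qed

text \<open>Both products are limits of one sequence, since the averages already commute with
  \<open>S\<close>. The case where \<open>S\<close> is \<open>T\<close> turns
  \<open>T o\<^sub>L P = P\<close> into \<open>P o\<^sub>L T = P\<close>.\<close>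

lemma ergodic_limit_commute:
  fixes T P :: "'a::real_normed_vector \<Rightarrow>\<^sub>L 'a"
  assumes "ergodic_average T \<longlonglongrightarrow> P" "T o\<^sub>L S = S o\<^sub>L T"
  shows "P o\<^sub>L S = S o\<^sub>L P"
proof (rule LIMSEQ_unique)
  show "(\<lambda>n. ergodic_average T n o\<^sub>L S) \<longlonglongrightarrow> (P o\<^sub>L S)"
    by (intro blinfun_compose.tendsto tendsto_const assms)
  show "(\<lambda>n. ergodic_average T n o\<^sub>L S) \<longlonglongrightarrow> (S o\<^sub>L P)"
    unfolding ergodic_average_commute[OF assms(2)]
    by (intro blinfun_compose.tendsto tendsto_const assms)
qed

lemma ergodic_limit_projection:
  fixes T P :: "'a::banach \<Rightarrow>\<^sub>L 'a"
  assumes T: "contraction_op T" and lim: "ergodic_average T \<longlonglongrightarrow> P"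
  shows "is_projection_on_along P (fixed_space T) (coboundaries T)"
proof -
  have TP: "T o\<^sub>L P = P"
    using ergodic_limit_absorbs[OF T lim] .
  have PT: "P o\<^sub>L T = P"
    using ergodic_limit_commute[OF lim refl] TP by simp
  have AP: "ergodic_average T n o\<^sub>L P = P" if "n > 0" for n
    using ergodic_average_absorb_left[OF TP that] .
  have PA: "P o\<^sub>L ergodic_average T n = P" if "n > 0" for n
    using AP[OF that] ergodic_average_commute[of T P n] TP PT by simp
  have PP: "P o\<^sub>L P = P"
  proof (rule LIMSEQ_unique)
    show "(\<lambda>n. ergodic_average T n o\<^sub>L P) \<longlonglongrightarrow> (P o\<^sub>L P)"
      by (intro blinfun_compose.tendsto tendsto_const lim)
    \<comment> \<open>\<open>ergodic_average T 0\<close> is zero, so constancy is claimed only from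
      index 1 on.\<close>
    show "(\<lambda>n. ergodic_average T n o\<^sub>L P) \<longlonglongrightarrow> P"
      by (rule tendsto_eventually) (use AP in \<open>auto simp: eventually_sequentially intro!: exI[of _ 1]\<close>)
  qed
  have fix_P: "P x = x" if "T x = x" for x
  proof (rule LIMSEQ_unique)
    have pow: "op_power T k x = x" for k
      by (induction k) (simp_all add: that)
    have "ergodic_average T n x = x" if "n > 0" for n
      using that by (simp add: ergodic_average_def blinfun.scaleR_left blinfun.sum_left pow
          sum_constant_scaleR)
    then show "(\<lambda>n. ergodic_average T n x) \<longlonglongrightarrow> x"
      by (intro tendsto_eventually) (auto simp: eventually_sequentially intro!: exI[of _ 1])
    show "(\<lambda>n. ergodic_average T n x) \<longlonglongrightarrow> P x"
      by (intro blinfun.tendsto tendsto_const lim)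
  qed
  have "range (blinfun_apply P) = fixed_space T"
    using fix_P TP unfolding fixed_space_def
    by (auto simp flip: blinfun_apply_blinfun_compose) (metis rangeI)
  moreover have "{x. P x = 0} = coboundaries T"
  proof (intro equalityI subsetI)
    fix x assume "x \<in> {x. P x = 0}"
    then have Px: "P x = 0" by simp
    obtain N where N: "\<And>n. n \<ge> N \<Longrightarrow> norm (ergodic_average T n - P) < 1"
      using LIMSEQ_D[OF lim, of 1] by auto
    \<comment> \<open>The successor makes \<open>n\<close> positive, as the factorisation of
      \<open>id_blinfun - ergodic_average T n\<close> requires.\<close>
    define n where "n = Suc N"
    have n: "n > 0" "norm (ergodic_average T n - P) < 1"
      using N by (auto simp: n_def)
    obtain y where y: "y - (ergodic_average T n - P) y = x"
      using surj_id_minus_small[OF n(2)] .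
    have "P y - (P (ergodic_average T n y) - P (P y)) = P x"
      by (simp add: blinfun.diff_right blinfun.diff_left flip: y)
    then have "P y = 0"
      using PA[OF n(1)] PP Px by (simp flip: blinfun_apply_blinfun_compose)
    then have "x = (id_blinfun - ergodic_average T n) y"
      using y by (simp add: blinfun.diff_left)
    then show "x \<in> coboundaries T"
      using id_minus_ergodic_average_factor[OF n(1), of T]
      by (metis blinfun_apply_blinfun_compose coboundaries_def rangeI)
  next
    fix x assume "x \<in> coboundaries T"
    then show "x \<in> {x. P x = 0}"
      using PT by (auto simp: coboundaries_def blinfun.diff_right blinfun.diff_left
          simp flip: blinfun_apply_blinfun_compose)
  qed
  ultimately show ?thesis
    using PP by (simp add: is_projection_on_along_def)
qed

text \<open>Split \<open>x\<close> as \<open>E x + (x - E x)\<close>. The first summand lies in the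
  common range, where \<open>F\<close> is the identity, and the second in the common null space, so
  applying \<open>F\<close> gives \<open>E x\<close>.\<close>

lemma is_projection_on_along_unique:
  assumes "is_projection_on_along E U V" "is_projection_on_along F U V"
  shows "E = F"
proof (rule blinfun_eqI)
  fix x
  have idem: "E (E z) = E z" "F (F z) = F z" for z
    using assms by (metis blinfun_apply_blinfun_compose is_projection_on_along_def)+
  have "E (x - E x) = 0"
    by (simp add: blinfun.diff_right idem)
  then have "F (x - E x) = 0"
    using assms by (auto simp: is_projection_on_along_def)
  moreover have "F (E x) = E x"
  proof -
    have "E x \<in> range F"
      using assms by (auto simp: is_projection_on_along_def)
    then show ?thesis
      using idem by auto
  qed
  ultimately show "E x = F x"
    by (simp add: blinfun.diff_right)
qed

section \<open>Convergence of the double averages\<close>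

lemma double_average_estimate:
  fixes T S P :: "'a::real_normed_vector \<Rightarrow>\<^sub>L 'a"
  assumes S: "contraction_op S" and PS: "P o\<^sub>L S = S o\<^sub>L P" and SP: "S o\<^sub>L P = P" and m: "m > 0"
  shows "norm ((1 / (real n * real m)) *\<^sub>R
      (\<Sum>k=0..n. \<Sum>j=0..m. op_power T k o\<^sub>L op_power S j) - P)
    \<le> 2 * norm ((1 / real n) *\<^sub>R (\<Sum>k=0..n. op_power T k) - P) + norm P / real m"
proof -
  define A where "A = (1 / real n) *\<^sub>R (\<Sum>k=0..n. op_power T k)"
  define B where "B = (1 / real m) *\<^sub>R (\<Sum>j=0..m. op_power S j)"
  have "(1 / (real n * real m)) *\<^sub>R (\<Sum>k=0..n. \<Sum>j=0..m. op_power T k o\<^sub>L op_power S j) = A o\<^sub>L B"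
  proof -
    have "(\<Sum>k=0..n. \<Sum>j=0..m. op_power T k o\<^sub>L op_power S j) =
        (\<Sum>k=0..n. op_power T k) o\<^sub>L (\<Sum>j=0..m. op_power S j)"
      unfolding blinfun_compose.sum_left unfolding blinfun_compose.sum_right ..
    then show ?thesis
      by (simp add: A_def B_def blinfun_compose.scaleR_left blinfun_compose.scaleR_right mult.commute)
  qed
  \<comment> \<open>\<open>P\<close> absorbs each of the \<open>m + 1\<close> powers, but the
    divisor is \<open>m\<close>; the surplus term is the error \<open>P / m\<close>.\<close>
  moreover have "(P o\<^sub>L B) - P = (1 / real m) *\<^sub>R P"
  proof -
    have "P o\<^sub>L op_power S j = P" for j
      using op_power_commute[OF PS[symmetric]] op_power_absorb_left[OF SP] by metis
    then have "P o\<^sub>L B = (real (Suc m) / real m) *\<^sub>R P"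
      by (simp add: B_def blinfun_compose.scaleR_right blinfun_compose.sum_right sum_constant_scaleR)
    also have "real (Suc m) / real m = 1 + 1 / real m"
      using m by (simp add: field_simps)
    finally show ?thesis
      by (simp add: scaleR_add_left)
  qed
  \<comment> \<open>Split off \<open>P o\<^sub>L B\<close>: the norm error \<open>A - P\<close> is
    then only multiplied by the bounded \<open>B\<close>.\<close>
  then have "(A o\<^sub>L B) - P = ((A - P) o\<^sub>L B) + (1 / real m) *\<^sub>R P"
    by (simp add: blinfun_compose.diff_left algebra_simps)
  moreover have "norm B \<le> 2"
  proof -
    have "norm (\<Sum>j=0..m. op_power S j) \<le> (\<Sum>j=0..m. 1)"
      by (intro sum_norm_le norm_op_power_le_1 S)
    also have "\<dots> \<le> 2 * real m"
      using m by simp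
    finally show ?thesis
      using m by (simp add: B_def field_simps)
  qed
  then have "norm ((A - P) o\<^sub>L B) \<le> norm (A - P) * 2"
    by (meson mult_left_mono norm_blinfun_compose norm_ge_zero order_trans)
  then have "norm (((A - P) o\<^sub>L B) + (1 / real m) *\<^sub>R P) \<le> 2 * norm (A - P) + norm P / real m"
    using norm_triangle_ineq[of "(A - P) o\<^sub>L B" "(1 / real m) *\<^sub>R P"] by simp
  ultimately show ?thesis
    by (simp add: A_def)
qed

text \<open>The sum has \<open>n + 1\<close> terms but is divided by \<open>n\<close>.\<close>

lemma closed_average_tendsto:
  assumes "ergodic_average T \<longlonglongrightarrow> P"
  shows "(\<lambda>n. (1 / real n) *\<^sub>R (\<Sum>k=0..n. op_power T k)) \<longlonglongrightarrow> P"
proof -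
  have "(\<lambda>n. (real (Suc n) / real n) *\<^sub>R ergodic_average T (Suc n)) \<longlonglongrightarrow> 1 *\<^sub>R P"
    by (intro tendsto_scaleR LIMSEQ_Suc_n_over_n LIMSEQ_Suc assms)
  moreover have "(real (Suc n) / real n) *\<^sub>R ergodic_average T (Suc n) =
      (1 / real n) *\<^sub>R (\<Sum>k=0..n. op_power T k)" for n
    by (simp add: ergodic_average_def atLeast0AtMost lessThan_Suc_atMost del: of_nat_Suc sum.lessThan_Suc)
  ultimately show ?thesis
    by simp
qed

theorem lemma2p7:
  fixes T S :: "'a::banach \<Rightarrow>\<^sub>L 'a"
  assumes "contraction_op T" and "contraction_op S"
    and "T o\<^sub>L S = S o\<^sub>L T"
    and "mean_ergodic T" and "mean_ergodic S"
    and "fixed_space T = fixed_space S"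
    and "uniformly_ergodic T"
  shows "(coboundaries S \<subseteq> double_coboundaries T S
          \<and> joint_coboundaries T S \<subseteq> double_coboundaries T S)
       \<and> (\<exists>!E. is_projection_on_along E (fixed_space T) (coboundaries T))
       \<and> (\<forall>E. is_projection_on_along E (fixed_space T) (coboundaries T) \<longrightarrow>
            ((\<lambda>(n, m). norm ((1 / (real n * real m)) *\<^sub>R
                 (\<Sum>k=0..n. \<Sum>j=0..m. op_power T k o\<^sub>L op_power S j) - E))
              \<longlongrightarrow> 0) (filtercomap (\<lambda>(n, m). min n m) sequentially))"
proof -
  obtain P where P: "ergodic_average T \<longlonglongrightarrow> P"
    using assms(7) by (auto simp: uniformly_ergodic_def convergent_def)
  have proj: "is_projection_on_along P (fixed_space T) (coboundaries T)"
    using ergodic_limit_projection[OF assms(1) P] .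
  have PS: "P o\<^sub>L S = S o\<^sub>L P"
    using ergodic_limit_commute[OF P assms(3)] .
  \<comment> \<open>Here the equality of the two fixed spaces enters: \<open>P\<close> maps into the
    fixed vectors of \<open>T\<close>, hence of \<open>S\<close>.\<close>
  have "P x \<in> fixed_space S" for x
    using proj assms(6) by (auto simp: is_projection_on_along_def)
  then have SP: "S o\<^sub>L P = P"
    by (auto intro!: blinfun_eqI simp: fixed_space_def)
  have cob: "coboundaries S \<subseteq> double_coboundaries T S"
  proof
    fix x assume "x \<in> coboundaries S"
    then obtain u where u: "x = (id_blinfun - S) u"
      by (auto simp: coboundaries_def)
    have "P (u - P u) = 0"
      using proj by (simp add: is_projection_on_along_def blinfun.diff_right
          flip: blinfun_apply_blinfun_compose)
    then obtain w where w: "u - P u = (id_blinfun - T) w"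
      using proj by (auto simp: is_projection_on_along_def coboundaries_def)
    have "S (P u) = P u"
      using SP by (metis blinfun_apply_blinfun_compose)
    then have "x = (id_blinfun - S) (u - P u)"
      by (simp add: u blinfun.diff_right blinfun.diff_left)
    also have "\<dots> = ((id_blinfun - T) o\<^sub>L (id_blinfun - S)) w"
    proof -
      have "S (T w) = T (S w)"
        using assms(3) by (metis blinfun_apply_blinfun_compose)
      then show ?thesis
        by (simp add: w blinfun.diff_right blinfun.diff_left)
    qed
    finally show "x \<in> double_coboundaries T S"
      by (auto simp: double_coboundaries_def)
  qed
  define a where "a n = (1 / real n) *\<^sub>R (\<Sum>k=0..n. op_power T k)" for n
  define F where "F = filtercomap (\<lambda>(n::nat, m::nat). min n m) sequentially"
  have min_lim: "filterlim (\<lambda>(n, m). min n m) sequentially F"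
    unfolding F_def by (rule filterlim_filtercomap)
  \<comment> \<open>Each coordinate dominates the minimum, so along \<open>F\<close> both tend to
    infinity.\<close>
  have fst_lim: "filterlim fst sequentially F" and snd_lim: "filterlim snd sequentially F"
    by (rule filterlim_at_top_mono[OF min_lim]; simp add: case_prod_beta)+
  have "((\<lambda>(n, m). norm ((1 / (real n * real m)) *\<^sub>R
      (\<Sum>k=0..n. \<Sum>j=0..m. op_power T k o\<^sub>L op_power S j) - P)) \<longlongrightarrow> 0) F"
  proof (rule Lim_null_comparison)
    have "(\<lambda>n. norm (a n - P)) \<longlonglongrightarrow> 0"
      using closed_average_tendsto[OF P] unfolding a_def
      by (simp add: tendsto_norm_zero_iff LIM_zero)
    then have "((\<lambda>p. 2 * norm (a (fst p) - P) + norm P / real (snd p)) \<longlongrightarrow> 2 * 0 + 0) F"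
      by (intro tendsto_add tendsto_mult tendsto_const filterlim_compose[OF _ fst_lim]
          filterlim_compose[OF lim_const_over_n snd_lim])
    then show "((\<lambda>p. 2 * norm (a (fst p) - P) + norm P / real (snd p)) \<longlongrightarrow> 0) F"
      by simp
    \<comment> \<open>The estimate needs \<open>m > 0\<close>, which holds eventually along
      \<open>F\<close>.\<close>
    have "\<forall>\<^sub>F p in F. snd p > 0"
      using snd_lim by (rule eventually_compose_filterlim[OF eventually_gt_at_top])
    then show "\<forall>\<^sub>F p in F. norm (case p of (n, m) \<Rightarrow> norm ((1 / (real n * real m)) *\<^sub>R
        (\<Sum>k=0..n. \<Sum>j=0..m. op_power T k o\<^sub>L op_power S j) - P))
        \<le> 2 * norm (a (fst p) - P) + norm P / real (snd p)"
      by eventually_elim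
        (auto simp: a_def case_prod_beta
          intro!: double_average_estimate[OF assms(2) PS SP])
  qed
  \<comment> \<open>Uniqueness of the projection carries the limit from \<open>P\<close> to every
    admissible \<open>E\<close>.\<close>
  then show ?thesis
    using cob proj is_projection_on_along_unique[OF _ proj] unfolding F_def joint_coboundaries_def
    by blast
qed

end
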